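(* Let $\mathcal{F}=\{f_i\}_{i\in I}$ be a $J$-frame for a Krein space $\mathcal{H}$, let $\mathcal{G}=\{g_i\}_{i\in I}$ be a dual family for $\mathcal{F}$ with synthesis operator $V:\ell_2(I)\to\mathcal{H}$, and define $\mathcal{N}_\pm=\overline{\operatorname{span}\{g_i: i\in I_\pm\}}$. Then $\mathcal{G}$ is a $J$-frame for $\mathcal{H}$ if and only if $\mathcal{N}_+\cap\mathcal{N}_-=\{0\}$ and $$N(V)=\big(N(V)\cap\ell_2(I_+)\big)\oplus \big(N(V)\cap\ell_2(I_-)\big).$$
   Context: A (complex) Krein space is a vector space $\mathcal{H}$ with a hermitian sesquilinear form $[\cdot,\cdot]$ admitting a fundamental decomposition $\mathcal{H}=\mathcal{H}_+\dotplus\mathcal{H}_-$, direct and $[\cdot,\cdot]$-orthogonal, with $(\mathcal{H}_+,[\cdot,\cdot])$ and $(\mathcal{H}_-,-[\cdot,\cdot])$ Hilbert spaces. Fix one; the associated Hilbert inner product is $\langle x,y\rangle=[x_+,y_+]-[x_-,y_-]$, with norm $\|\cdot\|$ (the topology does not depend on the decomposition). A subspace $\mathcal{S}$ is uniformly $J$-positive (resp. uniformly $J$-negative) if there is $\alpha>0$ with $[x,x]\ge\alpha\|x\|^2$ (resp. $-[x,x]\ge\alpha\|x\|^2$) for all $x\in\mathcal{S}$; it is maximal if it is maximal under inclusion among such subspaces. A Bessel family is $\mathcal{F}=\{f_i\}_{i\in I}\subset\mathcal{H}$ with $\sum_i|\langle f,f_i\rangle|^2\le\beta\|f\|^2$ for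 all $f\in\mathcal{H}$ and some $\beta>0$; its synthesis operator is the bounded operator $T:\ell_2(I)\to\mathcal{H}$, $Tx=\sum_{i\in I}x_if_i$. Put $I_+=\{i: [f_i,f_i]\ge0\}$, $I_-=\{i:[f_i,f_i]<0\}$. Regard $\ell_2(I)=\ell_2(I_+)\oplus\ell_2(I_-)$, with orthogonal projections $P_\pm$ onto $\ell_2(I_\pm)$, and $T_\pm=TP_\pm$. The Bessel family $\mathcal{F}$ is a $J$-frame for $\mathcal{H}$ if the range $R(T_+)$ is a maximal uniformly $J$-positive subspace and $R(T_-)$ is a maximal uniformly $J$-negative subspace of $\mathcal{H}$. Convention: $\operatorname{sgn}(t)=1$ for $t\ge 0$ and $\operatorname{sgn}(t)=-1$ for $t<0$. A Bessel family $\mathcal{G}=\{g_i\}_{i\in I}$ is a dual family for the $J$-frame $\mathcal{F}$ if $\sigma_i:=\operatorname{sgn}[f_i,f_i]=\operatorname{sgn}[g_i,g_i]$ for every $i\in I$ and $f=\sum_{i\in I}\sigma_i[f,f_i]g_i=\sum_{i\in I}\sigma_i[f,g_i]f_i$ for every $f\in\mathcal{H}$. $N(\cdot)$ denotes the nullspace and $\oplus$ an orthogonal direct sum. *)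

theory Defs
  imports "HOL-Analysis.Analysis"
begin

section \<open>Krein spaces\<close>

class complex_vector = real_vector +
  fixes scaleC :: "complex \<Rightarrow> 'a \<Rightarrow> 'a"  (infixr "*\<^sub>C" 75)
  assumes scaleC_add_right: "a *\<^sub>C (x + y) = a *\<^sub>C x + a *\<^sub>C y"
    and scaleC_add_left: "(a + b) *\<^sub>C x = a *\<^sub>C x + b *\<^sub>C x"
    and scaleC_scaleC: "a *\<^sub>C (b *\<^sub>C x) = (a * b) *\<^sub>C x"
    and scaleC_one: "1 *\<^sub>C x = x"
    and scaleR_scaleC: "r *\<^sub>R x = complex_of_real r *\<^sub>C x"

abbreviation csubspace :: "'a::complex_vector set \<Rightarrow> bool"
  where "csubspace \<equiv> module.subspace scaleC"

abbreviation cspan :: "'a::complex_vector set \<Rightarrow> 'a set"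
  where "cspan \<equiv> module.span scaleC"

text \<open>
  A type of class \<open>krein_space\<close> is a Krein space together with a chosen fundamental
  decomposition \<open>H\<^sub>+\<close>, \<open>H\<^sub>-\<close>. The form is linear in its first argument. It is
  complex-valued, but \<open>[x, x]\<close> is real by hermitian symmetry; it is written
  \<open>Re (kform x x)\<close> where a real number is needed.

  The axiom \<open>inner_fundamental\<close> puts no condition on the Krein space: it says that the real
  inner product of the type is the real part of the associated Hilbert inner product
  \<open>[x\<^sub>+, y\<^sub>+] - [x\<^sub>-, y\<^sub>-]\<close>, so that the norm and topology of the type are the
  associated Hilbert norm and topology. The last two axioms are completeness of
  \<open>(H\<^sub>+, [\<cdot>,\<cdot>])\<close> and \<open>(H\<^sub>-, -[\<cdot>,\<cdot>])\<close> in their own norms; they do not use the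
  library predicate \<open>complete\<close> because a class specification over \<open>real_inner\<close> cannot
  refer to it.
\<close>

class krein_space = complex_vector + real_inner +
  fixes kform :: "'a \<Rightarrow> 'a \<Rightarrow> complex"
    and H_plus :: "'a set"
    and H_minus :: "'a set"
  assumes kform_add_left: "kform (x + y) z = kform x z + kform y z"
    and kform_scaleC_left: "kform (c *\<^sub>C x) y = c * kform x y"
    and kform_hermitian: "kform y x = cnj (kform x y)"
    and H_plus_add: "\<lbrakk>y \<in> H_plus; y' \<in> H_plus\<rbrakk> \<Longrightarrow> y + y' \<in> H_plus"
    and H_plus_scaleC: "y \<in> H_plus \<Longrightarrow> c *\<^sub>C y \<in> H_plus"
    and H_minus_add: "\<lbrakk>z \<in> H_minus; z' \<in> H_minus\<rbrakk> \<Longrightarrow> z + z' \<in> H_minus"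
    and H_minus_scaleC: "z \<in> H_minus \<Longrightarrow> c *\<^sub>C z \<in> H_minus"
    and fundamental_sum: "\<exists>y\<in>H_plus. \<exists>z\<in>H_minus. x = y + z"
    and fundamental_direct: "H_plus \<inter> H_minus = {0}"
    and fundamental_orthogonal: "\<lbrakk>y \<in> H_plus; z \<in> H_minus\<rbrakk> \<Longrightarrow> kform y z = 0"
    and H_plus_positive: "\<lbrakk>y \<in> H_plus; y \<noteq> 0\<rbrakk> \<Longrightarrow> Re (kform y y) > 0"
    and H_minus_negative: "\<lbrakk>z \<in> H_minus; z \<noteq> 0\<rbrakk> \<Longrightarrow> - Re (kform z z) > 0"
    and inner_fundamental:
      "\<lbrakk>y \<in> H_plus; y' \<in> H_plus; z \<in> H_minus; z' \<in> H_minus\<rbrakk>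
        \<Longrightarrow> inner (y + z) (y' + z') = Re (kform y y' - kform z z')"
    and H_plus_complete:
      "\<lbrakk>\<And>n. X n \<in> H_plus;
        \<And>e. e > 0 \<Longrightarrow> \<exists>N. \<forall>m\<ge>N. \<forall>n\<ge>N. sqrt (Re (kform (X m - X n) (X m - X n))) < e\<rbrakk>
        \<Longrightarrow> \<exists>x\<in>H_plus. (\<lambda>n. sqrt (Re (kform (X n - x) (X n - x)))) \<longlonglongrightarrow> 0"
    and H_minus_complete:
      "\<lbrakk>\<And>n. X n \<in> H_minus;
        \<And>e. e > 0 \<Longrightarrow> \<exists>N. \<forall>m\<ge>N. \<forall>n\<ge>N. sqrt (- Re (kform (X m - X n) (X m - X n))) < e\<rbrakk>
        \<Longrightarrow> \<exists>x\<in>H_minus. (\<lambda>n. sqrt (- Re (kform (X n - x) (X n - x)))) \<longlonglongrightarrow> 0"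

definition plus_part :: "'a::krein_space \<Rightarrow> 'a"
  where "plus_part x = (THE y. y \<in> H_plus \<and> (\<exists>z\<in>H_minus. x = y + z))"

definition minus_part :: "'a::krein_space \<Rightarrow> 'a"
  where "minus_part x = (THE z. z \<in> H_minus \<and> (\<exists>y\<in>H_plus. x = y + z))"

definition hinner :: "'a::krein_space \<Rightarrow> 'a \<Rightarrow> complex"
  where "hinner x y =
    kform (plus_part x) (plus_part y) - kform (minus_part x) (minus_part y)"

definition uniformly_J_positive :: "'a::krein_space set \<Rightarrow> bool"
  where "uniformly_J_positive S \<longleftrightarrow>
    csubspace S \<and> (\<exists>\<alpha>>0. \<forall>x\<in>S. Re (kform x x) \<ge> \<alpha> * (norm x)\<^sup>2)"

definition uniformly_J_negative :: "'a::krein_space set \<Rightarrow> bool"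
  where "uniformly_J_negative S \<longleftrightarrow>
    csubspace S \<and> (\<exists>\<alpha>>0. \<forall>x\<in>S. - Re (kform x x) \<ge> \<alpha> * (norm x)\<^sup>2)"

definition maximal_uniformly_J_positive :: "'a::krein_space set \<Rightarrow> bool"
  where "maximal_uniformly_J_positive S \<longleftrightarrow>
    uniformly_J_positive S \<and> (\<forall>S'. uniformly_J_positive S' \<and> S \<subseteq> S' \<longrightarrow> S' = S)"

definition maximal_uniformly_J_negative :: "'a::krein_space set \<Rightarrow> bool"
  where "maximal_uniformly_J_negative S \<longleftrightarrow>
    uniformly_J_negative S \<and> (\<forall>S'. uniformly_J_negative S' \<and> S \<subseteq> S' \<longrightarrow> S' = S)"


section \<open>Square-summable families\<close>

text \<open>
  Elements of \<open>\<ell>\<^sub>2(I)\<close> are extended by \<open>0\<close> outside \<open>I\<close>, so that \<open>\<ell>\<^sub>2(K)\<close>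
  is a subset of \<open>\<ell>\<^sub>2(I)\<close> for \<open>K \<subseteq> I\<close>.
\<close>

definition ell2 :: "'i set \<Rightarrow> ('i \<Rightarrow> complex) set"
  where "ell2 I = {x. (\<forall>i. i \<notin> I \<longrightarrow> x i = 0) \<and> (\<lambda>i. (cmod (x i))\<^sup>2) summable_on I}"

definition ell2_inner :: "'i set \<Rightarrow> ('i \<Rightarrow> complex) \<Rightarrow> ('i \<Rightarrow> complex) \<Rightarrow> complex"
  where "ell2_inner I x y = (\<Sum>\<^sub>\<infinity>i\<in>I. x i * cnj (y i))"

definition ell2_proj :: "'i set \<Rightarrow> ('i \<Rightarrow> complex) \<Rightarrow> ('i \<Rightarrow> complex)"
  where "ell2_proj K x = (\<lambda>i. if i \<in> K then x i else 0)"

definition ell2_orthogonal_sum ::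
    "'i set \<Rightarrow> ('i \<Rightarrow> complex) set \<Rightarrow> ('i \<Rightarrow> complex) set \<Rightarrow> ('i \<Rightarrow> complex) set \<Rightarrow> bool"
  where "ell2_orthogonal_sum I N A B \<longleftrightarrow>
    N = {\<lambda>i. a i + b i | a b. a \<in> A \<and> b \<in> B} \<and>
    A \<inter> B = {\<lambda>i. 0} \<and>
    (\<forall>a\<in>A. \<forall>b\<in>B. ell2_inner I a b = 0)"


section \<open>J-frames and dual families\<close>

definition Bessel_family :: "'i set \<Rightarrow> ('i \<Rightarrow> 'a::krein_space) \<Rightarrow> bool"
  where "Bessel_family I f \<longleftrightarrow>
    (\<exists>\<beta>>0. \<forall>x. (\<lambda>i. (cmod (hinner x (f i)))\<^sup>2) summable_on I \<and>
      (\<Sum>\<^sub>\<infinity>i\<in>I. (cmod (hinner x (f i)))\<^sup>2) \<le> \<beta> * (norm x)\<^sup>2)"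

definition synthesis :: "'i set \<Rightarrow> ('i \<Rightarrow> 'a::krein_space) \<Rightarrow> ('i \<Rightarrow> complex) \<Rightarrow> 'a"
  where "synthesis I f x = (\<Sum>\<^sub>\<infinity>i\<in>I. x i *\<^sub>C f i)"

definition synthesis_kernel :: "'i set \<Rightarrow> ('i \<Rightarrow> 'a::krein_space) \<Rightarrow> ('i \<Rightarrow> complex) set"
  where "synthesis_kernel I f = {x \<in> ell2 I. synthesis I f x = 0}"

definition I_plus :: "'i set \<Rightarrow> ('i \<Rightarrow> 'a::krein_space) \<Rightarrow> 'i set"
  where "I_plus I f = {i \<in> I. Re (kform (f i) (f i)) \<ge> 0}"

definition I_minus :: "'i set \<Rightarrow> ('i \<Rightarrow> 'a::krein_space) \<Rightarrow> 'i set"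
  where "I_minus I f = {i \<in> I. Re (kform (f i) (f i)) < 0}"

definition J_frame :: "'i set \<Rightarrow> ('i \<Rightarrow> 'a::krein_space) \<Rightarrow> bool"
  where "J_frame I f \<longleftrightarrow>
    Bessel_family I f \<and>
    maximal_uniformly_J_positive ((\<lambda>x. synthesis I f (ell2_proj (I_plus I f) x)) ` ell2 I) \<and>
    maximal_uniformly_J_negative ((\<lambda>x. synthesis I f (ell2_proj (I_minus I f) x)) ` ell2 I)"

text \<open>Unlike the library function \<open>sgn\<close>, the sign used here takes the value \<open>1\<close> at \<open>0\<close>.\<close>

definition sgn01 :: "real \<Rightarrow> real"
  where "sgn01 t = (if t \<ge> 0 then 1 else - 1)"

definition J_sign :: "'a::krein_space \<Rightarrow> real"
  where "J_sign x = sgn01 (Re (kform x x))"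

definition dual_family :: "'i set \<Rightarrow> ('i \<Rightarrow> 'a::krein_space) \<Rightarrow> ('i \<Rightarrow> 'a) \<Rightarrow> bool"
  where "dual_family I f g \<longleftrightarrow>
    Bessel_family I g \<and>
    (\<forall>i\<in>I. J_sign (f i) = J_sign (g i)) \<and>
    (\<forall>x. ((\<lambda>i. (of_real (J_sign (f i)) * kform x (f i)) *\<^sub>C g i) has_sum x) I \<and>
         ((\<lambda>i. (of_real (J_sign (f i)) * kform x (g i)) *\<^sub>C f i) has_sum x) I)"

end

theory Submission imports Defs
begin

text \<open>
  Write \<open>T\<^sub>\<plusminus>\<close> and \<open>V\<^sub>\<plusminus>\<close> for the synthesis operators of \<open>f\<close> and \<open>g\<close> restricted to the
  indices of either sign, \<open>N\<^sub>\<plusminus>\<close> for the closed spans of the \<open>g\<^sub>i\<close>, and \<open>\<bottom>\<close> for orthogonality with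
  respect to the indefinite form.

  Suppose that \<open>g\<close> is a \<open>J\<close>-frame. The closure of a uniformly definite subspace is uniformly
  definite, so the maximal subspaces \<open>R(V\<^sub>\<plusminus>)\<close> are closed and contain \<open>N\<^sub>\<plusminus>\<close>. Subspaces of opposite
  definiteness meet only in \<open>0\<close>, hence \<open>N\<^sub>+ \<inter> N\<^sub>- = {0}\<close>
  (\<open>J_frame_closure_spans_disjoint\<close>). If \<open>V x = 0\<close>, then \<open>V\<^sub>+ x = - V\<^sub>- x\<close> lies in this
  intersection, so both halves of \<open>x\<close> are in the kernel (\<open>synthesis_kernel_splits\<close>).

  Conversely, the idea is to identify \<open>R(V\<^sub>+)\<close> with \<open>P = R(T\<^sub>-)\<^sup>\<bottom>\<close> and \<open>R(V\<^sub>-)\<close> with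
  \<open>Q = R(T\<^sub>+)\<^sup>\<bottom>\<close>. The expansion of \<open>x\<close> in the \<open>f\<^sub>i\<close> shows that \<open>R(T\<^sub>+)\<close> and \<open>R(T\<^sub>-)\<close> span the
  space. If \<open>x = a + b\<close> with \<open>a \<in> R(T\<^sub>+)\<close>, \<open>b \<in> R(T\<^sub>-)\<close> and \<open>x \<bottom> b\<close>, then
  \<open>[x,x] = [a,a] - [b,b]\<close>; this makes \<open>P\<close> uniformly positive, and likewise \<open>Q\<close> uniformly
  negative (\<open>kform_orthogonal_uniformly_definite\<close>). In the expansion of \<open>x\<close> in the \<open>g\<^sub>i\<close>, the sum
  over the nonnegative indices is the image of \<open>x\<close> under the adjoint of the projection onto
  \<open>R(T\<^sub>+)\<close> along \<open>R(T\<^sub>-)\<close>, so it belongs to \<open>P\<close>, and the rest of the sum belongs to \<open>Q\<close>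
  (\<open>partial_expansion_orthogonal\<close>). Thus every \<open>x\<close> is the sum of an element of \<open>P \<inter> R(V\<^sub>+)\<close> and
  one of \<open>Q \<inter> R(V\<^sub>-)\<close>. As both \<open>P \<inter> Q\<close> and \<open>N\<^sub>+ \<inter> N\<^sub>-\<close> are trivial, this forces
  \<open>R(V\<^sub>+) = P\<close> and \<open>R(V\<^sub>-) = Q\<close> (\<open>summand_eq_refinement\<close>). Finally a uniformly positive subspace
  with a uniformly negative complement is maximal, because a larger one would meet the complement
  (\<open>complemented_imp_maximal\<close>).
\<close>

section \<open>The Hilbert space of a fundamental decomposition\<close>

interpretation complex_space: module "scaleC :: complex \<Rightarrow> 'a \<Rightarrow> 'a::complex_vector"
  by unfold_locales (simp_all add: scaleC_add_right scaleC_add_left scaleC_scaleC scaleC_one)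

lemma kform_add_right: "kform x (y + z) = kform x y + kform x z"
  for x :: "'a::krein_space"
  by (metis complex_cnj_add kform_add_left kform_hermitian)

lemma kform_scaleC_right: "kform x (c *\<^sub>C y) = cnj c * kform x y"
  for x :: "'a::krein_space"
  by (metis complex_cnj_mult kform_scaleC_left kform_hermitian)

lemma kform_scaleR_left: "kform (r *\<^sub>R x) y = complex_of_real r * kform x y"
  for x :: "'a::krein_space"
  by (simp add: scaleR_scaleC kform_scaleC_left)

lemma kform_scaleR_right: "kform x (r *\<^sub>R y) = complex_of_real r * kform x y"
  for x :: "'a::krein_space"
  by (simp add: scaleR_scaleC kform_scaleC_right)

lemma kform_minus_left: "kform (- x) y = - kform x y" for x :: "'a::krein_space"
  using kform_scaleR_left[of "-1" x y] by simp

lemma kform_minus_right: "kform x (- y) = - kform x y" for x :: "'a::krein_space"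
  using kform_scaleR_right[of x "-1" y] by simp

lemma kform_diff_left: "kform (x - y) z = kform x z - kform y z" for x :: "'a::krein_space"
  using kform_add_left[of x "- y" z] by (simp add: kform_minus_left)

lemma kform_zero_left [simp]: "kform 0 y = 0" for y :: "'a::krein_space"
  using kform_scaleR_left[of 0 0 y] by simp

lemma kform_zero_right [simp]: "kform y 0 = 0" for y :: "'a::krein_space"
  using kform_scaleR_right[of y 0 0] by simp

lemma kform_sum_right: "kform x (\<Sum>i\<in>F. y i) = (\<Sum>i\<in>F. kform x (y i))"
  for x :: "'a::krein_space"
  by (induction F rule: infinite_finite_induct) (simp_all add: kform_add_right)

lemma zero_in_H_plus [simp]: "0 \<in> H_plus"
  using fundamental_direct by blast

lemma zero_in_H_minus [simp]: "0 \<in> H_minus"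
  using fundamental_direct by blast

lemma uminus_in_H_plus: "y \<in> H_plus \<Longrightarrow> - y \<in> H_plus"
  using H_plus_scaleC[of y "-1"] by (metis of_real_1 of_real_minus scaleR_scaleC scaleR_minus1_left)

lemma uminus_in_H_minus: "y \<in> H_minus \<Longrightarrow> - y \<in> H_minus"
  using H_minus_scaleC[of y "-1"] by (metis of_real_1 of_real_minus scaleR_scaleC scaleR_minus1_left)

lemma fundamental_unique:
  fixes y y' z z' :: "'a::krein_space"
  assumes "y \<in> H_plus" "y' \<in> H_plus" "z \<in> H_minus" "z' \<in> H_minus" "y + z = y' + z'"
  shows "y = y' \<and> z = z'"
proof -
  have eq: "y - y' = z' - z" using assms(5) by (simp add: algebra_simps)
  have "y - y' \<in> H_plus"
    using H_plus_add[OF assms(1) uminus_in_H_plus[OF assms(2)]] by simp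
  moreover have "z' - z \<in> H_minus"
    using H_minus_add[OF assms(4) uminus_in_H_minus[OF assms(3)]] by simp
  ultimately have "y - y' = 0" using eq fundamental_direct by (metis IntI singletonD)
  then show ?thesis using assms(5) by simp
qed

lemma plus_part_eq: "y \<in> H_plus \<Longrightarrow> z \<in> H_minus \<Longrightarrow> plus_part (y + z) = y"
  unfolding plus_part_def by (rule the_equality) (use fundamental_unique in blast)+

lemma minus_part_eq: "y \<in> H_plus \<Longrightarrow> z \<in> H_minus \<Longrightarrow> minus_part (y + z) = z"
  unfolding minus_part_def by (rule the_equality) (use fundamental_unique in blast)+

lemma plus_part_in [simp]: "plus_part x \<in> H_plus"
  by (metis fundamental_sum plus_part_eq)

lemma minus_part_in [simp]: "minus_part x \<in> H_minus"
  by (metis fundamental_sum minus_part_eq)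

lemma parts_sum: "plus_part x + minus_part x = x"
  by (metis fundamental_sum minus_part_eq plus_part_eq)

lemma plus_part_diff: "plus_part (x - y) = plus_part x - plus_part y"
proof -
  have "x - y = (plus_part x + - plus_part y) + (minus_part x + - minus_part y)"
    using parts_sum[of x] parts_sum[of y] by (simp add: algebra_simps)
  then show ?thesis
    using plus_part_eq[OF H_plus_add[OF plus_part_in uminus_in_H_plus[OF plus_part_in]]
        H_minus_add[OF minus_part_in uminus_in_H_minus[OF minus_part_in]]]
    by (metis add_uminus_conv_diff)
qed

lemma minus_part_diff: "minus_part (x - y) = minus_part x - minus_part y"
proof -
  have "minus_part u = u - plus_part u" for u :: 'a
    using parts_sum[of u] by (simp add: algebra_simps)
  then show ?thesis by (simp add: plus_part_diff)
qed

text \<open>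
  The operator usually called \<open>J\<close>. It turns the indefinite form into the Hilbert inner product, so
  that a bound for one of them transfers to the other.
\<close>

definition fundamental_symmetry :: "'a::krein_space \<Rightarrow> 'a"
  where "fundamental_symmetry x = plus_part x - minus_part x"

lemma fundamental_symmetry_parts:
  "plus_part (fundamental_symmetry x) = plus_part x"
  "minus_part (fundamental_symmetry x) = - minus_part x"
  using plus_part_eq[OF plus_part_in uminus_in_H_minus[OF minus_part_in]]
    minus_part_eq[OF plus_part_in uminus_in_H_minus[OF minus_part_in]]
  unfolding fundamental_symmetry_def by (metis add_uminus_conv_diff)+

lemma fundamental_symmetry_involution [simp]:
  "fundamental_symmetry (fundamental_symmetry x) = x"
  using parts_sum[of x]
  by (simp add: fundamental_symmetry_def[of "fundamental_symmetry x"] fundamental_symmetry_parts)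

lemma fundamental_orthogonal': "y \<in> H_plus \<Longrightarrow> z \<in> H_minus \<Longrightarrow> kform z y = 0"
  by (metis complex_cnj_zero fundamental_orthogonal kform_hermitian)

lemma hinner_eq_kform: "hinner x y = kform (fundamental_symmetry x) y"
proof -
  have "kform (fundamental_symmetry x) y
      = kform (plus_part x - minus_part x) (plus_part y + minus_part y)"
    by (simp add: fundamental_symmetry_def parts_sum)
  also have "\<dots> = hinner x y"
    by (simp add: hinner_def kform_diff_left kform_add_right fundamental_orthogonal
        fundamental_orthogonal')
  finally show ?thesis by simp
qed

lemma inner_eq_Re_hinner: "inner x y = Re (hinner x y)"
  using inner_fundamental[of "plus_part x" "plus_part y" "minus_part x" "minus_part y"]
  by (simp add: hinner_def parts_sum)

lemma inner_eq_Re_kform: "inner x y = Re (kform (fundamental_symmetry x) y)"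
  by (simp add: inner_eq_Re_hinner hinner_eq_kform)

lemma norm_fundamental_symmetry [simp]: "norm (fundamental_symmetry x) = norm x"
  by (simp add: norm_eq_sqrt_inner inner_eq_Re_hinner hinner_def fundamental_symmetry_parts
      kform_minus_left kform_minus_right)

lemma norm_scaleC: "norm (c *\<^sub>C x) = cmod c * norm x" for x :: "'a::krein_space"
proof -
  have split: "c *\<^sub>C x = c *\<^sub>C plus_part x + c *\<^sub>C minus_part x"
    by (metis parts_sum scaleC_add_right)
  have cnj: "c * cnj c = complex_of_real ((cmod c)\<^sup>2)"
    by (simp only: complex_norm_square)
  have "inner (c *\<^sub>C x) (c *\<^sub>C x) = Re (kform (c *\<^sub>C plus_part x) (c *\<^sub>C plus_part x)
      - kform (c *\<^sub>C minus_part x) (c *\<^sub>C minus_part x))"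
    unfolding split by (intro inner_fundamental H_plus_scaleC H_minus_scaleC) simp_all
  also have "\<dots> = Re ((c * cnj c) * hinner x x)"
    by (simp add: kform_scaleC_left kform_scaleC_right hinner_def algebra_simps)
  also have "\<dots> = (cmod c)\<^sup>2 * inner x x"
    unfolding cnj by (simp only: inner_eq_Re_hinner times_complex.sel Re_complex_of_real Im_complex_of_real mult_zero_left diff_0_right)
  finally show ?thesis
    by (simp add: norm_eq_sqrt_inner real_sqrt_mult)
qed

lemma bounded_linear_scaleC: "bounded_linear (\<lambda>x::'a::krein_space. c *\<^sub>C x)"
proof (rule bounded_linear_intro[where K = "cmod c"])
  show "c *\<^sub>C (r *\<^sub>R x) = r *\<^sub>R (c *\<^sub>C x)" for r and x :: 'a
    by (simp add: scaleR_scaleC scaleC_scaleC mult.commute)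
qed (simp_all add: scaleC_add_right norm_scaleC mult.commute)

text \<open>
  The real inner product only controls the real part of the form; the imaginary part is the real
  part after \<open>y\<close> is multiplied by \<open>\<i>\<close>. This costs the factor 2, which is harmless because
  only continuity matters.
\<close>

lemma norm_kform_le: "cmod (kform x y) \<le> norm x * norm y * 2"
  for x y :: "'a::krein_space"
proof -
  have Re_bound: "\<bar>Re (kform x y)\<bar> \<le> norm x * norm y" for y :: 'a
    using Cauchy_Schwarz_ineq2[of "fundamental_symmetry x" y]
    by (simp add: inner_eq_Re_kform)
  have "\<bar>Im (kform x y)\<bar> \<le> norm x * norm y"
    using Re_bound[of "\<i> *\<^sub>C y"] by (simp add: kform_scaleC_right norm_scaleC)
  then show ?thesis
    using Re_bound[of y] cmod_le[of "kform x y"] by linarith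
qed

lemma bounded_bilinear_kform: "bounded_bilinear (kform :: 'a::krein_space \<Rightarrow> 'a \<Rightarrow> complex)"
proof
  show "\<exists>K. \<forall>a b::'a. norm (kform a b) \<le> norm a * norm b * K"
    using norm_kform_le by blast
qed (simp_all add: kform_add_left kform_add_right kform_scaleR_left kform_scaleR_right
    scaleR_conv_of_real)

text \<open>
  The two axioms of completeness speak of the norms given by the form on \<open>H_plus\<close> and \<open>H_minus\<close>.
  These are the restrictions of the norm, and both projections are contractions, so the components
  of a Cauchy sequence converge separately. The conclusion gives convergence of infinite sums
  over arbitrary index sets.
\<close>

lemma complete_krein_space: "complete (UNIV :: 'a::krein_space set)"
  unfolding complete_def
proof (intro allI impI)
  fix X :: "nat \<Rightarrow> 'a"
  assume "(\<forall>n. X n \<in> UNIV) \<and> Cauchy X"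
  then have X: "Cauchy X" by simp
  have norm_plus: "norm y = sqrt (Re (kform y y))" if "y \<in> H_plus" for y :: 'a
    using inner_fundamental[OF that that zero_in_H_minus zero_in_H_minus]
    by (simp add: norm_eq_sqrt_inner)
  have norm_minus: "norm z = sqrt (- Re (kform z z))" if "z \<in> H_minus" for z :: 'a
    using inner_fundamental[OF zero_in_H_plus zero_in_H_plus that that]
    by (simp add: norm_eq_sqrt_inner)
  have norm_sq: "(norm x)\<^sup>2 = (norm (plus_part x))\<^sup>2 + (norm (minus_part x))\<^sup>2" for x :: 'a
    using inner_eq_Re_hinner[of x x]
      inner_fundamental[of "plus_part x" "plus_part x" 0 0]
      inner_fundamental[of 0 0 "minus_part x" "minus_part x"]
    by (simp add: power2_norm_eq_inner hinner_def)
  have plus_le: "norm (plus_part x) \<le> norm x" for x :: 'a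
  proof (rule power2_le_imp_le)
    show "(norm (plus_part x))\<^sup>2 \<le> (norm x)\<^sup>2"
      using norm_sq[of x] zero_le_power2[of "norm (minus_part x)"] by linarith
  qed simp
  have minus_le: "norm (minus_part x) \<le> norm x" for x :: 'a
  proof (rule power2_le_imp_le)
    show "(norm (minus_part x))\<^sup>2 \<le> (norm x)\<^sup>2"
      using norm_sq[of x] zero_le_power2[of "norm (plus_part x)"] by linarith
  qed simp
  have diff_plus: "y - y' \<in> H_plus" if "y \<in> H_plus" "y' \<in> H_plus" for y y' :: 'a
    using H_plus_add[OF that(1) uminus_in_H_plus[OF that(2)]] by simp
  have diff_minus: "y - y' \<in> H_minus" if "y \<in> H_minus" "y' \<in> H_minus" for y y' :: 'a
    using H_minus_add[OF that(1) uminus_in_H_minus[OF that(2)]] by simp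
  have "\<exists>y\<in>H_plus. (\<lambda>n. sqrt (Re (kform (plus_part (X n) - y) (plus_part (X n) - y))))
      \<longlonglongrightarrow> 0"
  proof (rule H_plus_complete)
    fix e :: real assume "e > 0"
    then obtain N where N: "\<forall>m\<ge>N. \<forall>n\<ge>N. norm (X m - X n) < e"
      using X unfolding Cauchy_iff by blast
    show "\<exists>N. \<forall>m\<ge>N. \<forall>n\<ge>N.
        sqrt (Re (kform (plus_part (X m) - plus_part (X n)) (plus_part (X m) - plus_part (X n)))) < e"
      using N plus_le
      by (metis norm_plus[OF plus_part_in] plus_part_diff order_le_less_trans)
  qed simp
  then obtain y where y: "y \<in> H_plus" "(\<lambda>n. norm (plus_part (X n) - y)) \<longlonglongrightarrow> 0"
    using norm_plus diff_plus by auto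
  have "\<exists>z\<in>H_minus. (\<lambda>n. sqrt (- Re (kform (minus_part (X n) - z) (minus_part (X n) - z))))
      \<longlonglongrightarrow> 0"
  proof (rule H_minus_complete)
    fix e :: real assume "e > 0"
    then obtain N where N: "\<forall>m\<ge>N. \<forall>n\<ge>N. norm (X m - X n) < e"
      using X unfolding Cauchy_iff by blast
    show "\<exists>N. \<forall>m\<ge>N. \<forall>n\<ge>N.
        sqrt (- Re (kform (minus_part (X m) - minus_part (X n)) (minus_part (X m) - minus_part (X n)))) < e"
      using N minus_le
      by (metis norm_minus[OF minus_part_in] minus_part_diff order_le_less_trans)
  qed simp
  then obtain z where z: "z \<in> H_minus" "(\<lambda>n. norm (minus_part (X n) - z)) \<longlonglongrightarrow> 0"
    using norm_minus diff_minus by auto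
  have "(\<lambda>n. plus_part (X n) + minus_part (X n)) \<longlonglongrightarrow> y + z"
    using y(2) z(2) by (intro tendsto_add) (simp_all add: LIM_zero_cancel tendsto_norm_zero_iff)
  then show "\<exists>l\<in>UNIV. X \<longlonglongrightarrow> l"
    by (auto simp: parts_sum)
qed

section \<open>Uniformly definite subspaces\<close>

text \<open>
  The sign \<open>s\<close> is \<open>1\<close> or \<open>- 1\<close>, so that each argument for positive subspaces also
  serves for negative ones.
\<close>

definition uniformly_definite :: "real \<Rightarrow> 'a::krein_space set \<Rightarrow> bool"
  where "uniformly_definite s S \<longleftrightarrow>
    csubspace S \<and> (\<exists>\<alpha>>0. \<forall>x\<in>S. s * Re (kform x x) \<ge> \<alpha> * (norm x)\<^sup>2)"

definition maximal_uniformly_definite :: "real \<Rightarrow> 'a::krein_space set \<Rightarrow> bool"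
  where "maximal_uniformly_definite s S \<longleftrightarrow>
    uniformly_definite s S \<and> (\<forall>S'. uniformly_definite s S' \<and> S \<subseteq> S' \<longrightarrow> S' = S)"

lemma maximal_uniformly_definite_signs:
  "maximal_uniformly_J_positive = maximal_uniformly_definite 1"
  "maximal_uniformly_J_negative = maximal_uniformly_definite (- 1)"
  by (simp_all add: fun_eq_iff maximal_uniformly_definite_def maximal_uniformly_J_positive_def
      maximal_uniformly_J_negative_def uniformly_definite_def uniformly_J_positive_def
      uniformly_J_negative_def)

lemma csubspace_closure:
  fixes S :: "'a::krein_space set"
  assumes "csubspace S"
  shows "csubspace (closure S)"
proof (rule complex_space.subspaceI)
  show "0 \<in> closure S"
    using assms closure_subset complex_space.subspace_0 by blast
next
  fix x y assume "x \<in> closure S" "y \<in> closure S"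
  then obtain X Y where XY: "\<forall>n. X n \<in> S" "X \<longlonglongrightarrow> x" "\<forall>n. Y n \<in> S" "Y \<longlonglongrightarrow> y"
    unfolding closure_sequential by blast
  then have "\<forall>n. X n + Y n \<in> S" "(\<lambda>n. X n + Y n) \<longlonglongrightarrow> x + y"
    using assms by (auto intro: complex_space.subspace_add tendsto_add)
  then show "x + y \<in> closure S"
    by (intro closure_sequential[THEN iffD2] exI conjI)
next
  fix c x assume "x \<in> closure S"
  then obtain X where X: "\<forall>n. X n \<in> S" "X \<longlonglongrightarrow> x"
    unfolding closure_sequential by blast
  then have "\<forall>n. c *\<^sub>C X n \<in> S" "(\<lambda>n. c *\<^sub>C X n) \<longlonglongrightarrow> c *\<^sub>C x"
    using assms by (auto intro: complex_space.subspace_scale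
        bounded_linear.tendsto[OF bounded_linear_scaleC])
  then show "c *\<^sub>C x \<in> closure S"
    by (intro closure_sequential[THEN iffD2] exI conjI)
qed

text \<open>
  By continuity the defining inequality persists, with the same constant, on the closure; maximality
  then leaves no room between the subspace and its closure.
\<close>

lemma maximal_uniformly_definite_closed:
  assumes "maximal_uniformly_definite s S"
  shows "closed S"
proof -
  from assms obtain \<alpha> where S: "csubspace S" and \<alpha>: "\<alpha> > 0"
    "\<And>x. x \<in> S \<Longrightarrow> \<alpha> * (norm x)\<^sup>2 \<le> s * Re (kform x x)"
    unfolding maximal_uniformly_definite_def uniformly_definite_def by blast
  have "\<alpha> * (norm x)\<^sup>2 \<le> s * Re (kform x x)" if x: "x \<in> closure S" for x
  proof -
    obtain X where X: "\<forall>n. X n \<in> S" "X \<longlonglongrightarrow> x"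
      using x unfolding closure_sequential by blast
    have "(\<lambda>n. \<alpha> * (norm (X n))\<^sup>2) \<longlonglongrightarrow> \<alpha> * (norm x)\<^sup>2"
      using X(2) by (intro tendsto_intros)
    moreover have "(\<lambda>n. s * Re (kform (X n) (X n))) \<longlonglongrightarrow> s * Re (kform x x)"
      using X(2) by (intro tendsto_intros bounded_bilinear.tendsto[OF bounded_bilinear_kform])
    ultimately show ?thesis
      using X(1) \<alpha>(2) by (auto intro: LIMSEQ_le)
  qed
  then have "uniformly_definite s (closure S)"
    using \<alpha>(1) csubspace_closure[OF S] unfolding uniformly_definite_def by blast
  then have "closure S = S"
    using assms closure_subset unfolding maximal_uniformly_definite_def by blast
  then show ?thesis by (metis closed_closure)
qed

lemma uniformly_definite_opposite_Int:
  assumes "uniformly_definite s P" "uniformly_definite (- s) Q"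
  shows "P \<inter> Q = {0}"
proof -
  obtain \<alpha> \<beta> where *: "\<alpha> > 0" "\<beta> > 0"
    "\<And>x. x \<in> P \<Longrightarrow> \<alpha> * (norm x)\<^sup>2 \<le> s * Re (kform x x)"
    "\<And>x. x \<in> Q \<Longrightarrow> \<beta> * (norm x)\<^sup>2 \<le> - s * Re (kform x x)"
    using assms unfolding uniformly_definite_def by blast
  have "x = 0" if "x \<in> P" "x \<in> Q" for x
  proof -
    have "(\<alpha> + \<beta>) * (norm x)\<^sup>2 \<le> 0"
      using *(3)[OF that(1)] *(4)[OF that(2)] by (simp add: algebra_simps)
    then show ?thesis using *(1,2) by (simp add: mult_le_0_iff)
  qed
  moreover have "0 \<in> P" "0 \<in> Q"
    using assms complex_space.subspace_0 unfolding uniformly_definite_def by blast+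
  ultimately show ?thesis by blast
qed

text \<open>
  If a larger subspace \<open>S\<close> of the same sign contained \<open>p + q\<close>, it would contain \<open>q\<close>, which lies in a
  subspace of the opposite sign and therefore vanishes.
\<close>

lemma complemented_imp_maximal:
  assumes P: "uniformly_definite s P" and Q: "uniformly_definite (- s) Q"
    and sum: "\<And>x. \<exists>p\<in>P. \<exists>q\<in>Q. x = p + q"
  shows "maximal_uniformly_definite s P"
  unfolding maximal_uniformly_definite_def
proof (intro conjI allI impI P)
  fix S assume S: "uniformly_definite s S \<and> P \<subseteq> S"
  show "S = P"
  proof
    show "S \<subseteq> P"
    proof
      fix x assume x: "x \<in> S"
      obtain p q where pq: "p \<in> P" "q \<in> Q" "x = p + q" using sum by blast
      have "x - p \<in> S"
        using S x pq(1) complex_space.subspace_diff unfolding uniformly_definite_def by blast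
      then have "q \<in> S \<inter> Q" using pq by simp
      then have "q = 0" using uniformly_definite_opposite_Int[of s S Q] S Q by blast
      then show "x \<in> P" using pq by simp
    qed
  qed (use S in blast)
qed

definition kform_orthogonal :: "'a::krein_space set \<Rightarrow> 'a set"
  where "kform_orthogonal N = {x. \<forall>n\<in>N. kform x n = 0}"

lemma csubspace_kform_orthogonal: "csubspace (kform_orthogonal N)"
  by (rule complex_space.subspaceI)
     (simp_all add: kform_orthogonal_def kform_add_left kform_scaleC_left)

text \<open>
  For \<open>x = m + n\<close> orthogonal to \<open>n\<close>, the mixed term \<open>[m,n]\<close> equals \<open>- [n,n]\<close>, so
  \<open>[x,x] = [m,m] - [n,n]\<close>. Both terms on the right have the sign \<open>s\<close> and dominate the squared norms of
  \<open>m\<close> and \<open>n\<close>, hence that of \<open>x\<close>.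
\<close>

lemma kform_orthogonal_uniformly_definite:
  assumes M: "uniformly_definite s M" and N: "uniformly_definite (- s) N"
    and sum: "\<And>x. \<exists>m\<in>M. \<exists>n\<in>N. x = m + n"
  shows "uniformly_definite s (kform_orthogonal N)"
proof -
  obtain \<alpha> \<beta> where *: "\<alpha> > 0" "\<beta> > 0"
    "\<And>x. x \<in> M \<Longrightarrow> \<alpha> * (norm x)\<^sup>2 \<le> s * Re (kform x x)"
    "\<And>x. x \<in> N \<Longrightarrow> \<beta> * (norm x)\<^sup>2 \<le> - s * Re (kform x x)"
    using M N unfolding uniformly_definite_def by blast
  define \<gamma> where "\<gamma> = min \<alpha> \<beta>"
  have \<gamma>: "\<gamma> > 0" "\<gamma> \<le> \<alpha>" "\<gamma> \<le> \<beta>" using *(1,2) by (auto simp: \<gamma>_def)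
  have "\<gamma> / 2 * (norm x)\<^sup>2 \<le> s * Re (kform x x)" if x: "x \<in> kform_orthogonal N" for x
  proof -
    obtain m n where mn: "m \<in> M" "n \<in> N" "x = m + n" using sum by blast
    have "kform x n = 0" using x mn(2) by (simp add: kform_orthogonal_def)
    then have mn0: "kform m n = - kform n n"
      using mn(3) by (simp add: kform_add_left add_eq_0_iff)
    have "Re (kform x x) = Re (kform m m) + 2 * Re (kform m n) + Re (kform n n)"
      using arg_cong[OF kform_hermitian[of n m], of Re]
      by (simp add: mn(3) kform_add_left kform_add_right)
    then have form: "Re (kform x x) = Re (kform m m) - Re (kform n n)"
      by (simp add: mn0)
    have "(norm x)\<^sup>2 \<le> (norm m + norm n)\<^sup>2"
      by (simp add: mn(3) norm_triangle_ineq power_mono)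
    also have "\<dots> \<le> 2 * (norm m)\<^sup>2 + 2 * (norm n)\<^sup>2"
      using sum_squares_bound[of "norm m" "norm n"] by (simp add: power2_sum)
    finally have "\<gamma> / 2 * (norm x)\<^sup>2 \<le> \<gamma> / 2 * (2 * (norm m)\<^sup>2 + 2 * (norm n)\<^sup>2)"
      using \<gamma>(1) by (intro mult_left_mono) auto
    also have "\<dots> = \<gamma> * (norm m)\<^sup>2 + \<gamma> * (norm n)\<^sup>2" by (simp add: algebra_simps)
    also have "\<dots> \<le> \<alpha> * (norm m)\<^sup>2 + \<beta> * (norm n)\<^sup>2"
      using \<gamma> by (intro add_mono mult_right_mono) auto
    also have "\<dots> \<le> s * Re (kform m m) - s * Re (kform n n)"
      using *(3)[OF mn(1)] *(4)[OF mn(2)] by simp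
    finally show ?thesis by (simp add: form right_diff_distrib)
  qed
  then show ?thesis
    using \<gamma>(1) csubspace_kform_orthogonal unfolding uniformly_definite_def
    by (intro conjI exI[of _ "\<gamma> / 2"]) auto
qed

section \<open>Synthesis along Bessel families\<close>

text \<open>
  The Bessel condition is stated with the Hilbert inner product, but coefficients of expansions use
  the form. Replacing \<open>x\<close> by its image under the fundamental symmetry, an isometry, exchanges the two
  without changing the bound.
\<close>

lemma Bessel_kform:
  assumes "Bessel_family I f"
  obtains \<beta> where "\<beta> > 0"
    "\<And>x. (\<lambda>i. (cmod (kform x (f i)))\<^sup>2) summable_on I"
    "\<And>x F. finite F \<Longrightarrow> F \<subseteq> I \<Longrightarrow> (\<Sum>i\<in>F. (cmod (kform x (f i)))\<^sup>2) \<le> \<beta> * (norm x)\<^sup>2"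
proof -
  obtain \<beta> where \<beta>: "\<beta> > 0"
    "\<And>x. (\<lambda>i. (cmod (hinner x (f i)))\<^sup>2) summable_on I"
    "\<And>x. (\<Sum>\<^sub>\<infinity>i\<in>I. (cmod (hinner x (f i)))\<^sup>2) \<le> \<beta> * (norm x)\<^sup>2"
    using assms unfolding Bessel_family_def by blast
  have hinner: "kform x (f i) = hinner (fundamental_symmetry x) (f i)" for x i
    by (simp add: hinner_eq_kform)
  show ?thesis
  proof (rule that[OF \<beta>(1)])
    fix x
    show "(\<lambda>i. (cmod (kform x (f i)))\<^sup>2) summable_on I"
      unfolding hinner by (rule \<beta>(2))
    fix F assume F: "finite F" "F \<subseteq> I"
    have "(\<Sum>i\<in>F. (cmod (kform x (f i)))\<^sup>2)
        \<le> (\<Sum>\<^sub>\<infinity>i\<in>I. (cmod (hinner (fundamental_symmetry x) (f i)))\<^sup>2)"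
      unfolding hinner by (rule finite_sum_le_infsum[OF \<beta>(2) F]) simp
    also have "\<dots> \<le> \<beta> * (norm x)\<^sup>2"
      using \<beta>(3)[of "fundamental_symmetry x"] by simp
    finally show "(\<Sum>i\<in>F. (cmod (kform x (f i)))\<^sup>2) \<le> \<beta> * (norm x)\<^sup>2" .
  qed
qed

text \<open>
  Finite sums are bounded by duality: the squared norm of \<open>u = \<Sum> c\<^sub>i f\<^sub>i\<close> is its Hilbert
  pairing with itself, which the Cauchy-Schwarz inequality bounds by the norm of \<open>c\<close> times the square
  root of the Bessel sum of \<open>u\<close>, and one factor \<open>norm u\<close> cancels.
\<close>

lemma Bessel_norm_sum_le:
  assumes "Bessel_family I f"
  obtains \<beta> where "\<beta> > 0"
    "\<And>F c. finite F \<Longrightarrow> F \<subseteq> I \<Longrightarrow>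
      (norm (\<Sum>i\<in>F. c i *\<^sub>C f i))\<^sup>2 \<le> \<beta> * (\<Sum>i\<in>F. (cmod (c i))\<^sup>2)"
proof -
  obtain \<beta> where \<beta>: "\<beta> > 0"
    "\<And>x F. finite F \<Longrightarrow> F \<subseteq> I \<Longrightarrow> (\<Sum>i\<in>F. (cmod (kform x (f i)))\<^sup>2) \<le> \<beta> * (norm x)\<^sup>2"
    using Bessel_kform[OF assms] by metis
  show ?thesis
  proof (rule that[OF \<beta>(1)])
    fix F c assume F: "finite F" "F \<subseteq> I"
    define u where "u = (\<Sum>i\<in>F. c i *\<^sub>C f i)"
    define k where "k i = kform (fundamental_symmetry u) (f i)" for i
    have "(norm u)\<^sup>2 = Re (kform (fundamental_symmetry u) u)"
      by (simp add: power2_norm_eq_inner inner_eq_Re_kform)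
    also have "\<dots> = Re (\<Sum>i\<in>F. cnj (c i) * k i)"
      by (subst (2) u_def) (simp only: kform_sum_right kform_scaleC_right k_def)
    also have "\<dots> \<le> cmod (\<Sum>i\<in>F. cnj (c i) * k i)"
      by (rule complex_Re_le_cmod)
    also have "\<dots> \<le> (\<Sum>i\<in>F. cmod (c i) * cmod (k i))"
      by (rule order_trans[OF norm_sum]) (simp add: norm_mult)
    finally have "((norm u)\<^sup>2)\<^sup>2 \<le> (\<Sum>i\<in>F. cmod (c i) * cmod (k i))\<^sup>2"
      by (rule power_mono) simp
    also have "\<dots> \<le> (\<Sum>i\<in>F. (cmod (c i))\<^sup>2) * (\<Sum>i\<in>F. (cmod (k i))\<^sup>2)"
      by (rule Cauchy_Schwarz_ineq_sum)
    also have "\<dots> \<le> (\<Sum>i\<in>F. (cmod (c i))\<^sup>2) * (\<beta> * (norm u)\<^sup>2)"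
      using \<beta>(2)[OF F, of "fundamental_symmetry u"]
      by (intro mult_left_mono) (simp_all add: k_def sum_nonneg)
    finally have *: "(norm u)\<^sup>2 * (norm u)\<^sup>2 \<le> (\<beta> * (\<Sum>i\<in>F. (cmod (c i))\<^sup>2)) * (norm u)\<^sup>2"
      by (simp add: power2_eq_square mult_ac)
    show "(norm (\<Sum>i\<in>F. c i *\<^sub>C f i))\<^sup>2 \<le> \<beta> * (\<Sum>i\<in>F. (cmod (c i))\<^sup>2)"
    proof (cases "u = 0")
      case True
      then show ?thesis using \<beta>(1) by (simp add: u_def[symmetric] sum_nonneg)
    next
      case False
      then show ?thesis using * unfolding u_def[symmetric]
        by (intro mult_right_le_imp_le[OF *]) simp
    qed
  qed
qed

text \<open>
  Outside a large finite set the coefficients have small square sum, so by the estimate for finite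
  sums the partial sums form a Cauchy net.
\<close>

lemma Bessel_summable:
  fixes f :: "'i \<Rightarrow> 'a::krein_space"
  assumes "Bessel_family I f" "c \<in> ell2 I"
  shows "(\<lambda>i. c i *\<^sub>C f i) summable_on I"
proof -
  let ?s = "sum (\<lambda>i. c i *\<^sub>C f i)"
  let ?q = "sum (\<lambda>i. (cmod (c i))\<^sup>2)"
  obtain \<beta> where \<beta>: "\<beta> > 0"
    "\<And>F. finite F \<Longrightarrow> F \<subseteq> I \<Longrightarrow> (norm (?s F))\<^sup>2 \<le> \<beta> * ?q F"
    using Bessel_norm_sum_le[OF assms(1)] by metis
  have "cauchy_filter (filtermap ?s (finite_subsets_at_top I))"
    unfolding cauchy_filter_metric_filtermap
  proof (intro allI impI)
    fix e :: real assume e: "e > 0"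
    (* Square sums within d of the total differ by less than 2 * d, and \<beta> * (2 * d) = (e / 2)^2. *)
    define d where "d = (e / 2)\<^sup>2 / (2 * \<beta>)"
    have d: "d > 0" using e \<beta>(1) by (simp add: d_def)
    have "(?q \<longlongrightarrow> infsum (\<lambda>i. (cmod (c i))\<^sup>2) I) (finite_subsets_at_top I)"
      using assms(2) has_sum_infsum unfolding ell2_def has_sum_def by blast
    then have "\<forall>\<^sub>F F in finite_subsets_at_top I.
        dist (?q F) (infsum (\<lambda>i. (cmod (c i))\<^sup>2) I) < d"
      using d by (rule tendstoD)
    then obtain F0 where F0: "finite F0" "F0 \<subseteq> I"
      "\<And>F. finite F \<Longrightarrow> F0 \<subseteq> F \<Longrightarrow> F \<subseteq> I \<Longrightarrow>
        dist (?q F) (infsum (\<lambda>i. (cmod (c i))\<^sup>2) I) < d"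
      unfolding eventually_finite_subsets_at_top by metis
    have near: "dist (?s F) (?s F0) < e / 2" if F: "finite F" "F0 \<subseteq> F" "F \<subseteq> I" for F
    proof -
      have "?q (F - F0) = ?q F - ?q F0" using F by (simp add: sum_diff)
      also have "\<dots> < 2 * d"
        using F0(3)[OF F] F0(3)[OF F0(1) order_refl F0(2)] unfolding dist_real_def by linarith
      finally have q: "?q (F - F0) < 2 * d" .
      have "(norm (?s (F - F0)))\<^sup>2 \<le> \<beta> * ?q (F - F0)"
        using F by (intro \<beta>(2)) auto
      also have "\<dots> < \<beta> * (2 * d)" using q \<beta>(1) by (rule mult_strict_left_mono)
      also have "\<dots> = (e / 2)\<^sup>2" using \<beta>(1) by (simp add: d_def)
      finally have "norm (?s (F - F0)) < e / 2"
        by (rule power2_less_imp_less) (use e in simp)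
      then show ?thesis using F by (simp add: dist_norm sum_diff)
    qed
    have "\<forall>\<^sub>F F in finite_subsets_at_top I. finite F \<and> F0 \<subseteq> F \<and> F \<subseteq> I"
      unfolding eventually_finite_subsets_at_top using F0(1,2) by blast
    moreover have "dist (?s F) (?s G) < e"
      if "finite F \<and> F0 \<subseteq> F \<and> F \<subseteq> I" "finite G \<and> F0 \<subseteq> G \<and> G \<subseteq> I" for F G
      using dist_triangle_half_l[OF near near] that by blast
    ultimately show "\<exists>P. eventually P (finite_subsets_at_top I) \<and>
        (\<forall>F G. P F \<and> P G \<longrightarrow> dist (?s F) (?s G) < e)"
      by (intro exI[of _ "\<lambda>F. finite F \<and> F0 \<subseteq> F \<and> F \<subseteq> I"]) simp
  qed
  then obtain x where "filtermap ?s (finite_subsets_at_top I) \<le> nhds x"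
    using cauchy_filter_complete_converges[OF _ complete_krein_space, of
        "filtermap ?s (finite_subsets_at_top I)"]
    by (auto simp: filtermap_bot_iff)
  then show ?thesis
    unfolding summable_on_def has_sum_def filterlim_def by blast
qed

lemma Bessel_has_sum:
  assumes "Bessel_family I f" "c \<in> ell2 I"
  shows "((\<lambda>i. c i *\<^sub>C f i) has_sum synthesis I f c) I"
  unfolding synthesis_def by (intro has_sum_infsum Bessel_summable assms)

lemma ell2_proj_in_ell2: "c \<in> ell2 I \<Longrightarrow> ell2_proj K c \<in> ell2 I"
  unfolding ell2_def ell2_proj_def
  by (auto elim!: summable_on_comparison_test)

lemma synthesis_add_has_sum:
  assumes "Bessel_family I f" "a \<in> ell2 I" "b \<in> ell2 I"
  shows "((\<lambda>i. (a i + b i) *\<^sub>C f i) has_sum (synthesis I f a + synthesis I f b)) I"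
  using has_sum_add[OF Bessel_has_sum[OF assms(1,2)] Bessel_has_sum[OF assms(1,3)]]
  by (simp add: scaleC_add_left)

lemma ell2_proj_split:
  assumes "c \<in> ell2 I" "K \<union> L = I" "K \<inter> L = {}"
  shows "(\<lambda>i. ell2_proj K c i + ell2_proj L c i) = c"
  using assms by (auto simp: ell2_proj_def ell2_def fun_eq_iff)

lemma synthesis_proj_split:
  assumes "Bessel_family I f" "c \<in> ell2 I" "K \<union> L = I" "K \<inter> L = {}"
  shows "synthesis I f (ell2_proj K c) + synthesis I f (ell2_proj L c) = synthesis I f c"
proof -
  note c = ell2_proj_in_ell2[OF assms(2)]
  have "((\<lambda>i. c i *\<^sub>C f i) has_sum
      (synthesis I f (ell2_proj K c) + synthesis I f (ell2_proj L c))) I"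
    using synthesis_add_has_sum[OF assms(1) c c, of K L] ell2_proj_split[OF assms(2-4)]
    by (simp add: fun_eq_iff)
  then show ?thesis
    by (rule has_sum_unique) (rule Bessel_has_sum[OF assms(1,2)])
qed

definition synthesis_range :: "'i set \<Rightarrow> ('i \<Rightarrow> 'a::krein_space) \<Rightarrow> 'i set \<Rightarrow> 'a set"
  where "synthesis_range I f K = (\<lambda>c. synthesis I f (ell2_proj K c)) ` ell2 I"

lemma has_sum_in_closure_csubspace:
  fixes h :: "'i \<Rightarrow> 'a::krein_space"
  assumes "(h has_sum x) I" "csubspace S" "\<And>i. i \<in> I \<Longrightarrow> h i \<in> S"
  shows "x \<in> closure S"
proof -
  have "\<forall>\<^sub>F F in finite_subsets_at_top I. sum h F \<in> closure S"
  proof (rule eventually_finite_subsets_at_top_weakI)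
    fix F assume "finite F" "F \<subseteq> I"
    then have "sum h F \<in> S"
      by (intro complex_space.subspace_sum[OF assms(2)] assms(3)) blast
    then show "sum h F \<in> closure S" using closure_subset by blast
  qed
  then show ?thesis
    using assms(1) unfolding has_sum_def by (intro Lim_in_closed_set[OF closed_closure]) auto
qed

lemma synthesis_range_subset_closure_span:
  assumes "Bessel_family I f"
  shows "synthesis_range I f K \<subseteq> closure (cspan (f ` K))"
proof
  fix x assume "x \<in> synthesis_range I f K"
  then obtain c where c: "c \<in> ell2 I" "x = synthesis I f (ell2_proj K c)"
    unfolding synthesis_range_def by blast
  have "((\<lambda>i. ell2_proj K c i *\<^sub>C f i) has_sum x) I"
    unfolding c(2) by (intro Bessel_has_sum assms ell2_proj_in_ell2 c(1))
  then show "x \<in> closure (cspan (f ` K))"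
    by (rule has_sum_in_closure_csubspace)
       (auto simp: ell2_proj_def complex_space.span_base complex_space.span_scale
         complex_space.span_zero)
qed

text \<open>
  The range contains each \<open>f\<^sub>k\<close> as the image of a unit vector, and by maximality it is a closed
  subspace.
\<close>

lemma closure_span_subset_synthesis_range:
  fixes f :: "'i \<Rightarrow> 'a::krein_space"
  assumes "K \<subseteq> I" "maximal_uniformly_definite s (synthesis_range I f K)"
  shows "closure (cspan (f ` K)) \<subseteq> synthesis_range I f K"
proof (rule closure_minimal[OF complex_space.span_minimal
      maximal_uniformly_definite_closed[OF assms(2)]])
  show "f ` K \<subseteq> synthesis_range I f K"
  proof
    fix y assume "y \<in> f ` K"
    then obtain k where k: "k \<in> K" "y = f k" by blast
    define e :: "'i \<Rightarrow> complex" where "e i = (if i = k then 1 else 0)" for i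
    have kI: "k \<in> I" using k assms(1) by blast
    have "(\<lambda>i. (cmod (e i))\<^sup>2) summable_on I \<longleftrightarrow> (\<lambda>i. (cmod (e i))\<^sup>2) summable_on {k}"
      using kI by (intro summable_on_cong_neutral) (auto simp: e_def)
    then have "e \<in> ell2 I" using kI by (auto simp: ell2_def e_def)
    moreover have "ell2_proj K e = e" using k by (auto simp: ell2_proj_def e_def fun_eq_iff)
    moreover have "synthesis I f e = f k"
    proof -
      have "((\<lambda>i. e i *\<^sub>C f i) has_sum f k) I \<longleftrightarrow> ((\<lambda>i. e i *\<^sub>C f i) has_sum f k) {k}"
        using kI by (intro has_sum_cong_neutral) (auto simp: e_def)
      moreover have "((\<lambda>i. e i *\<^sub>C f i) has_sum f k) {k}"
        using has_sum_finite[of "{k}" "\<lambda>i. e i *\<^sub>C f i"] by (simp add: e_def scaleC_one)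
      ultimately show ?thesis unfolding synthesis_def by (blast intro: infsumI)
    qed
    ultimately show "y \<in> synthesis_range I f K"
      unfolding synthesis_range_def k(2) by (metis imageI)
  qed
  show "csubspace (synthesis_range I f K)"
    using assms(2) by (simp add: maximal_uniformly_definite_def uniformly_definite_def)
qed

section \<open>The two halves of a dual expansion\<close>

text \<open>
  The coefficients of \<open>x\<close> in the expansion along a dual of \<open>f\<close>: the adjoint of the synthesis operator
  of \<open>f\<close>, taken with respect to the indefinite forms on both sides.
\<close>

definition analysis :: "'i set \<Rightarrow> ('i \<Rightarrow> 'a::krein_space) \<Rightarrow> 'a \<Rightarrow> 'i \<Rightarrow> complex"
  where "analysis I f x i = (if i \<in> I then of_real (J_sign (f i)) * kform x (f i) else 0)"

definition partial_expansion ::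
    "'i set \<Rightarrow> ('i \<Rightarrow> 'a::krein_space) \<Rightarrow> ('i \<Rightarrow> 'a) \<Rightarrow> 'i set \<Rightarrow> 'a \<Rightarrow> 'a"
  where "partial_expansion I f g K x = synthesis I g (ell2_proj K (analysis I f x))"

lemma abs_J_sign [simp]: "\<bar>J_sign x\<bar> = 1"
  by (simp add: J_sign_def sgn01_def)

lemma analysis_in_ell2:
  assumes "Bessel_family I f"
  shows "analysis I f x \<in> ell2 I"
proof -
  have "(\<lambda>i. (cmod (kform x (f i)))\<^sup>2) summable_on I"
    using Bessel_kform[OF assms] by metis
  then have "(\<lambda>i. (cmod (analysis I f x i))\<^sup>2) summable_on I"
    by (rule summable_on_cong[THEN iffD2, rotated]) (simp add: analysis_def norm_mult)
  then show ?thesis by (simp add: ell2_def analysis_def)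
qed

lemma partial_expansion_has_sum:
  assumes "Bessel_family I f" "Bessel_family I g"
  shows "((\<lambda>i. ell2_proj K (analysis I f x) i *\<^sub>C g i) has_sum partial_expansion I f g K x) I"
  unfolding partial_expansion_def
  by (intro Bessel_has_sum ell2_proj_in_ell2 analysis_in_ell2 assms)

lemma partial_expansion_in_range:
  assumes "Bessel_family I f"
  shows "partial_expansion I f g K x \<in> synthesis_range I g K"
  unfolding partial_expansion_def synthesis_range_def
  using analysis_in_ell2[OF assms] by blast

lemma partial_expansion_sum:
  assumes "Bessel_family I f" "Bessel_family I g" "K \<union> L = I" "K \<inter> L = {}"
    and "((\<lambda>i. (of_real (J_sign (f i)) * kform x (f i)) *\<^sub>C g i) has_sum x) I"
  shows "partial_expansion I f g K x + partial_expansion I f g L x = x"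
proof -
  have "((\<lambda>i. analysis I f x i *\<^sub>C g i) has_sum x) I"
    by (rule has_sum_cong[THEN iffD1, OF _ assms(5)]) (simp add: analysis_def)
  then have "synthesis I g (analysis I f x) = x"
    unfolding synthesis_def by (rule infsumI)
  then show ?thesis
    unfolding partial_expansion_def
    using synthesis_proj_split[OF assms(2) analysis_in_ell2[OF assms(1)] assms(3,4)] by simp
qed

text \<open>
  The term of index \<open>i\<close> is \<open>\<sigma>\<^sub>i [x,f\<^sub>i] [g\<^sub>i,y]\<close> on both sides. The signs of the two families must agree for
  this, because the left side carries that of \<open>f\<^sub>i\<close> and the right side that of \<open>g\<^sub>i\<close>.
\<close>

lemma partial_expansion_adjoint:
  assumes "Bessel_family I f" "Bessel_family I g"
    and signs: "\<And>i. i \<in> I \<Longrightarrow> J_sign (f i) = J_sign (g i)"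
  shows "kform (partial_expansion I f g K x) y = kform x (partial_expansion I g f K y)"
proof -
  have left: "((\<lambda>i. kform (ell2_proj K (analysis I f x) i *\<^sub>C g i) y) has_sum
      kform (partial_expansion I f g K x) y) I"
    by (rule has_sum_bounded_linear[OF bounded_bilinear.bounded_linear_left[OF
          bounded_bilinear_kform] partial_expansion_has_sum[OF assms(1,2)]])
  have right: "((\<lambda>i. kform x (ell2_proj K (analysis I g y) i *\<^sub>C f i)) has_sum
      kform x (partial_expansion I g f K y)) I"
    by (rule has_sum_bounded_linear[OF bounded_bilinear.bounded_linear_right[OF
          bounded_bilinear_kform] partial_expansion_has_sum[OF assms(2,1)]])
  have "kform (ell2_proj K (analysis I f x) i *\<^sub>C g i) y
      = kform x (ell2_proj K (analysis I g y) i *\<^sub>C f i)" if "i \<in> I" for i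
    using signs[OF that] kform_hermitian[of "g i" y]
    by (simp add: ell2_proj_def analysis_def kform_scaleC_left kform_scaleC_right mult_ac)
  then show ?thesis
    using has_sum_cong[THEN iffD1, OF _ left] right by (metis (no_types, lifting) has_sum_unique)
qed

text \<open>
  In the expansion of \<open>m\<close> along \<open>f\<close>, the two halves lie in the ranges for \<open>K\<close> and \<open>L\<close>. If \<open>m\<close> is in the
  range for \<open>L\<close> and the ranges are independent, its half over \<open>K\<close> vanishes. Passing to the adjoint, the
  half over \<open>K\<close> of any expansion along \<open>g\<close> is orthogonal to \<open>m\<close>.
\<close>

lemma partial_expansion_orthogonal:
  assumes "Bessel_family I f" "Bessel_family I g"
    and "\<And>i. i \<in> I \<Longrightarrow> J_sign (f i) = J_sign (g i)"
    and KL: "K \<union> L = I" "K \<inter> L = {}"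
    and exp: "\<And>x. ((\<lambda>i. (of_real (J_sign (g i)) * kform x (g i)) *\<^sub>C f i) has_sum x) I"
    and L: "csubspace (synthesis_range I f L)"
    and trivial: "synthesis_range I f K \<inter> synthesis_range I f L = {0}"
  shows "partial_expansion I f g K x \<in> kform_orthogonal (synthesis_range I f L)"
  unfolding kform_orthogonal_def
proof (intro CollectI ballI)
  fix m assume m: "m \<in> synthesis_range I f L"
  have "m - partial_expansion I g f L m = partial_expansion I g f K m"
    using partial_expansion_sum[OF assms(2,1) KL exp, of m] by (simp add: algebra_simps)
  moreover have "m - partial_expansion I g f L m \<in> synthesis_range I f L"
    using m partial_expansion_in_range[OF assms(2)] by (intro complex_space.subspace_diff[OF L])
  ultimately have "partial_expansion I g f K m = 0"
    using partial_expansion_in_range[OF assms(2)] trivial by (metis IntI singletonD)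
  then show "kform (partial_expansion I f g K x) m = 0"
    using partial_expansion_adjoint[OF assms(1-3)] by simp
qed

text \<open>
  Subtracting the component in \<open>P \<inter> A\<close> from an element of \<open>A\<close> leaves an element of \<open>N \<inter> N'\<close>, and
  subtracting it from an element of \<open>P\<close> leaves one of \<open>P \<inter> Q\<close>; both differences are \<open>0\<close>. The sets
  \<open>A\<close> and \<open>B\<close> will be the ranges for \<open>g\<close>, which are not known to be closed at that stage, and \<open>N\<close>, \<open>N'\<close> the
  closed spans.
\<close>

lemma summand_eq_refinement:
  fixes P Q A B N N' :: "'a::krein_space set"
  assumes split: "\<And>x. \<exists>p \<in> P \<inter> A. \<exists>q \<in> Q \<inter> B. x = p + q"
    and "A \<subseteq> N" "B \<subseteq> N'" "csubspace N" "N \<inter> N' = {0}" "csubspace P" "P \<inter> Q = {0}"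
  shows "A = P"
proof (intro equalityI subsetI)
  fix x assume x: "x \<in> A"
  obtain p q where pq: "p \<in> P" "p \<in> A" "q \<in> B" "x = p + q" using split by blast
  then have "x - p \<in> N" using x assms(2,4) by (intro complex_space.subspace_diff) auto
  then have "q \<in> N \<inter> N'" using pq assms(3) by auto
  then show "x \<in> P" using pq assms(5) by simp
next
  fix x assume x: "x \<in> P"
  obtain p q where pq: "p \<in> P" "p \<in> A" "q \<in> Q" "x = p + q" using split by blast
  then have "x - p \<in> P" using x assms(6) by (intro complex_space.subspace_diff) auto
  then have "q \<in> P \<inter> Q" using pq by auto
  then show "x \<in> A" using pq assms(7) by simp
qed

section \<open>Dual families that are frames\<close>

lemma J_frame_iff:
  "J_frame I f \<longleftrightarrow> Bessel_family I f \<and>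
    maximal_uniformly_definite 1 (synthesis_range I f (I_plus I f)) \<and>
    maximal_uniformly_definite (- 1) (synthesis_range I f (I_minus I f))"
  by (simp add: J_frame_def maximal_uniformly_definite_signs synthesis_range_def)

lemma sign_sets_partition: "I_plus I f \<union> I_minus I f = I" "I_plus I f \<inter> I_minus I f = {}"
  by (auto simp: I_plus_def I_minus_def)

lemma dual_family_sign_sets:
  assumes "dual_family I f g"
  shows "I_plus I g = I_plus I f" "I_minus I g = I_minus I f"
proof -
  have "Re (kform (g i) (g i)) \<ge> 0 \<longleftrightarrow> Re (kform (f i) (f i)) \<ge> 0" if "i \<in> I" for i
    using assms that unfolding dual_family_def J_sign_def sgn01_def
    by (smt (verit, best))
  then show "I_plus I g = I_plus I f" "I_minus I g = I_minus I f"
    by (auto simp: I_plus_def I_minus_def not_le[symmetric])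
qed

lemma J_frame_closure_spans_disjoint:
  assumes "J_frame I g"
  shows "closure (cspan (g ` I_plus I g)) \<inter> closure (cspan (g ` I_minus I g)) = {0}"
proof -
  have R: "maximal_uniformly_definite 1 (synthesis_range I g (I_plus I g))"
    "maximal_uniformly_definite (- 1) (synthesis_range I g (I_minus I g))"
    using assms by (simp_all add: J_frame_iff)
  have "closure (cspan (g ` I_plus I g)) \<subseteq> synthesis_range I g (I_plus I g)"
    by (rule closure_span_subset_synthesis_range[OF _ R(1)]) (auto simp: I_plus_def)
  moreover have "closure (cspan (g ` I_minus I g)) \<subseteq> synthesis_range I g (I_minus I g)"
    by (rule closure_span_subset_synthesis_range[OF _ R(2)]) (auto simp: I_minus_def)
  moreover have "synthesis_range I g (I_plus I g) \<inter> synthesis_range I g (I_minus I g) = {0}"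
    using R uniformly_definite_opposite_Int by (auto simp: maximal_uniformly_definite_def)
  moreover have "0 \<in> closure (cspan (g ` K))" for K
    using closure_subset complex_space.span_zero by blast
  ultimately show ?thesis
    by (intro equalityI) (metis Int_mono, simp)
qed

text \<open>
  The two halves of a kernel vector are mapped to opposite vectors, which lie in the two closed
  spans and therefore vanish.
\<close>

lemma synthesis_kernel_splits:
  assumes g: "Bessel_family I g" and KL: "K \<union> L = I" "K \<inter> L = {}"
    and trivial: "closure (cspan (g ` K)) \<inter> closure (cspan (g ` L)) = {0}"
  shows "ell2_orthogonal_sum I (synthesis_kernel I g)
      (synthesis_kernel I g \<inter> ell2 K) (synthesis_kernel I g \<inter> ell2 L)"
  unfolding ell2_orthogonal_sum_def
proof (intro conjI ballI)
  let ?N = "synthesis_kernel I g"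
  have proj_ell2: "ell2_proj M c \<in> ell2 M" if "c \<in> ell2 I" "M \<subseteq> I" for M c
  proof -
    have "(\<lambda>i. (cmod (c i))\<^sup>2) summable_on M"
      using that by (auto simp: ell2_def intro: summable_on_subset_banach)
    then have "(\<lambda>i. (cmod (ell2_proj M c i))\<^sup>2) summable_on M"
      by (rule summable_on_cong[THEN iffD2, rotated]) (simp add: ell2_proj_def)
    then show ?thesis by (simp add: ell2_def ell2_proj_def)
  qed
  have proj_range: "synthesis I g (ell2_proj M c) \<in> closure (cspan (g ` M))"
    if "c \<in> ell2 I" for M c
    using synthesis_range_subset_closure_span[OF g, of M] that
    unfolding synthesis_range_def by blast
  show "?N = {\<lambda>i. a i + b i | a b. a \<in> ?N \<inter> ell2 K \<and> b \<in> ?N \<inter> ell2 L}"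
  proof (intro equalityI subsetI)
    fix c assume "c \<in> ?N"
    then have c: "c \<in> ell2 I" "synthesis I g c = 0" by (simp_all add: synthesis_kernel_def)
    have sum0: "synthesis I g (ell2_proj K c) + synthesis I g (ell2_proj L c) = 0"
      using synthesis_proj_split[OF g c(1) KL] c(2) by simp
    have "csubspace (closure (cspan (g ` L)))"
      by (intro csubspace_closure complex_space.subspace_span)
    then have "- synthesis I g (ell2_proj L c) \<in> closure (cspan (g ` L))"
      using proj_range[OF c(1)] by (rule complex_space.subspace_neg)
    then have "synthesis I g (ell2_proj K c) \<in> closure (cspan (g ` L))"
      using sum0 by (metis eq_neg_iff_add_eq_0)
    then have "synthesis I g (ell2_proj K c) = 0"
      using trivial proj_range[OF c(1), of K] by blast
    then have "ell2_proj K c \<in> ?N \<inter> ell2 K" "ell2_proj L c \<in> ?N \<inter> ell2 L"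
      using sum0 ell2_proj_in_ell2[OF c(1)] proj_ell2[OF c(1)] KL
      by (auto simp: synthesis_kernel_def)
    then show "c \<in> {\<lambda>i. a i + b i | a b. a \<in> ?N \<inter> ell2 K \<and> b \<in> ?N \<inter> ell2 L}"
      using ell2_proj_split[OF c(1) KL]
      by (intro CollectI exI[of _ "ell2_proj K c"] exI[of _ "ell2_proj L c"]) simp
  next
    fix c assume "c \<in> {\<lambda>i. a i + b i | a b. a \<in> ?N \<inter> ell2 K \<and> b \<in> ?N \<inter> ell2 L}"
    then obtain a b where ab: "c = (\<lambda>i. a i + b i)" "a \<in> ?N" "a \<in> ell2 K" "b \<in> ?N" "b \<in> ell2 L"
      by blast
    have kernel: "synthesis I g a = 0" "synthesis I g b = 0" "a \<in> ell2 I" "b \<in> ell2 I"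
      using ab by (simp_all add: synthesis_kernel_def)
    have "synthesis I g c = 0"
      using synthesis_add_has_sum[OF g kernel(3,4)] kernel(1,2)
      unfolding synthesis_def ab(1) by (simp add: infsumI)
    moreover have "c \<in> ell2 I"
    proof -
      have "(cmod (c i))\<^sup>2 = (cmod (a i))\<^sup>2 + (cmod (b i))\<^sup>2" for i
        using ab KL by (cases "i \<in> K") (auto simp: ell2_def)
      then show ?thesis
        using kernel(3,4) by (simp add: ell2_def summable_on_add ab(1))
    qed
    ultimately show "c \<in> ?N" by (simp add: synthesis_kernel_def)
  qed
  have "(\<lambda>i. 0) \<in> ?N" "(\<lambda>i. 0) \<in> ell2 K" "(\<lambda>i. 0) \<in> ell2 L"
    by (simp_all add: synthesis_kernel_def ell2_def synthesis_def)
  moreover have "c = (\<lambda>i. 0)" if "c \<in> ell2 K" "c \<in> ell2 L" for c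
    using that KL(2) by (auto simp: ell2_def fun_eq_iff)
  ultimately show "?N \<inter> ell2 K \<inter> (?N \<inter> ell2 L) = {\<lambda>i. 0}" by blast
  fix a b assume "a \<in> ?N \<inter> ell2 K" "b \<in> ?N \<inter> ell2 L"
  then have "a i * cnj (b i) = 0" for i using KL(2) by (cases "i \<in> K") (auto simp: ell2_def)
  then show "ell2_inner I a b = 0" unfolding ell2_inner_def by (rule infsum_0)
qed

lemma dual_family_J_frame:
  assumes f: "J_frame I f" and dual: "dual_family I f g"
    and trivial: "closure (cspan (g ` I_plus I f)) \<inter> closure (cspan (g ` I_minus I f)) = {0}"
  shows "J_frame I g"
proof -
  let ?K = "I_plus I f" and ?L = "I_minus I f"
  let ?A = "synthesis_range I f ?K" and ?B = "synthesis_range I f ?L"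
  let ?P = "kform_orthogonal ?B" and ?Q = "kform_orthogonal ?A"
  have bessel: "Bessel_family I f" "Bessel_family I g"
    and A: "uniformly_definite 1 ?A" and B: "uniformly_definite (- 1) ?B"
    and signs: "\<And>i. i \<in> I \<Longrightarrow> J_sign (f i) = J_sign (g i)"
    and expf: "\<And>x. ((\<lambda>i. (of_real (J_sign (f i)) * kform x (f i)) *\<^sub>C g i) has_sum x) I"
    using f dual
    by (auto simp: J_frame_iff dual_family_def maximal_uniformly_definite_def)
  have expg: "((\<lambda>i. (of_real (J_sign (g i)) * kform x (g i)) *\<^sub>C f i) has_sum x) I" for x
  proof -
    have "((\<lambda>i. (of_real (J_sign (f i)) * kform x (g i)) *\<^sub>C f i) has_sum x) I"
      using dual by (simp add: dual_family_def)
    then show ?thesis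
      by (rule has_sum_cong[THEN iffD1, rotated]) (simp add: signs)
  qed
  note KL = sign_sets_partition[of I f]
  have LK: "?L \<union> ?K = I" "?L \<inter> ?K = {}" using KL by blast+
  have sum_AB: "\<exists>a\<in>?A. \<exists>b\<in>?B. x = a + b" for x
    using partial_expansion_sum[OF bessel(2,1) KL expg, of x]
      partial_expansion_in_range[OF bessel(2)] by metis
  have sum_BA: "\<exists>b\<in>?B. \<exists>a\<in>?A. x = b + a" for x
    using sum_AB by (metis add.commute)
  have P: "uniformly_definite 1 ?P"
    by (rule kform_orthogonal_uniformly_definite[OF A B sum_AB])
  have Q: "uniformly_definite (- 1) ?Q"
    by (rule kform_orthogonal_uniformly_definite[OF B _ sum_BA]) (use A in simp)
  have AB: "?A \<inter> ?B = {0}" by (rule uniformly_definite_opposite_Int[OF A B])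
  have PQ: "?P \<inter> ?Q = {0}" by (rule uniformly_definite_opposite_Int[OF P Q])
  have subspaces: "csubspace ?A" "csubspace ?B"
    using A B by (simp_all add: uniformly_definite_def)
  have split: "\<exists>p \<in> ?P \<inter> synthesis_range I g ?K. \<exists>q \<in> ?Q \<inter> synthesis_range I g ?L. x = p + q"
    for x
  proof (intro bexI IntI)
    show "x = partial_expansion I f g ?K x + partial_expansion I f g ?L x"
      using partial_expansion_sum[OF bessel KL expf] by simp
    show "partial_expansion I f g ?K x \<in> ?P"
      by (rule partial_expansion_orthogonal[OF bessel signs KL expg subspaces(2) AB])
    show "partial_expansion I f g ?L x \<in> ?Q"
      using AB by (intro partial_expansion_orthogonal[OF bessel signs LK expg subspaces(1)]) auto
  qed (rule partial_expansion_in_range[OF bessel(1)])+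
  have split': "\<exists>q \<in> ?Q \<inter> synthesis_range I g ?L. \<exists>p \<in> ?P \<inter> synthesis_range I g ?K. x = q + p"
    for x using split[of x] by (metis add.commute)
  have trivial': "closure (cspan (g ` ?L)) \<inter> closure (cspan (g ` ?K)) = {0}"
    using trivial by blast
  have QP: "?Q \<inter> ?P = {0}" using PQ by blast
  note sub = synthesis_range_subset_closure_span[OF bessel(2)]
    and closed_span = csubspace_closure[OF complex_space.subspace_span]
  have RK: "synthesis_range I g ?K = ?P"
    by (rule summand_eq_refinement[OF split sub sub closed_span trivial
          csubspace_kform_orthogonal PQ])
  have RL: "synthesis_range I g ?L = ?Q"
    by (rule summand_eq_refinement[OF split' sub sub closed_span trivial'
          csubspace_kform_orthogonal QP])
  have "maximal_uniformly_definite 1 ?P"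
    using split by (intro complemented_imp_maximal[OF P Q]) blast
  moreover have "maximal_uniformly_definite (- 1) ?Q"
    using split' P by (intro complemented_imp_maximal[OF Q, of ?P]) (simp, blast)
  ultimately show ?thesis
    by (simp add: J_frame_iff dual_family_sign_sets[OF dual] bessel(2) RK RL)
qed

theorem theorem4p3:
  fixes I :: "'i set" and f g :: "'i \<Rightarrow> 'a::krein_space"
  assumes "J_frame I f" and "dual_family I f g"
  shows "J_frame I g \<longleftrightarrow>
    closure (cspan (g ` I_plus I f)) \<inter> closure (cspan (g ` I_minus I f)) = {0} \<and>
    ell2_orthogonal_sum I (synthesis_kernel I g)
      (synthesis_kernel I g \<inter> ell2 (I_plus I f))
      (synthesis_kernel I g \<inter> ell2 (I_minus I f))"
proof
  assume "J_frame I g"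
  then have trivial:
    "closure (cspan (g ` I_plus I f)) \<inter> closure (cspan (g ` I_minus I f)) = {0}"
    using J_frame_closure_spans_disjoint[of I g] by (simp add: dual_family_sign_sets[OF assms(2)])
  have "Bessel_family I g" using assms(2) by (simp add: dual_family_def)
  then show "closure (cspan (g ` I_plus I f)) \<inter> closure (cspan (g ` I_minus I f)) = {0} \<and>
    ell2_orthogonal_sum I (synthesis_kernel I g)
      (synthesis_kernel I g \<inter> ell2 (I_plus I f))
      (synthesis_kernel I g \<inter> ell2 (I_minus I f))"
    using trivial synthesis_kernel_splits[OF _ sign_sets_partition trivial] by blast
next
  assume "closure (cspan (g ` I_plus I f)) \<inter> closure (cspan (g ` I_minus I f)) = {0} \<and>
    ell2_orthogonal_sum I (synthesis_kernel I g)
      (synthesis_kernel I g \<inter> ell2 (I_plus I f))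
      (synthesis_kernel I g \<inter> ell2 (I_minus I f))"
  then show "J_frame I g"
    using dual_family_J_frame[OF assms] by blast
qed

end
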